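(* For all $n,r\in\mathbb{N}_0$ and all $\omega$ (a variable, or any complex number), the polynomials ${}_{T}B_{n}^{(c,v)}(x,y,z;\lambda)$ satisfy $${}_{T}B_{n+r}^{(c,v)}(\omega,y,z;\lambda)=\sum_{\ell=0}^n\sum_{m=0}^r\binom{n}{\ell}\binom{r}{m}(\omega-x)^{\ell+m}\,{}_{T}B_{n+r-\ell-m}^{(c,v)}(x,y,z;\lambda).$$
   Context: $\mathbb{N}_0=\{0,1,2,\dots\}$; $x,y,z$ are variables (taking complex values) and $\lambda\in\mathbb{C}\setminus\{0\}$. Let $\mathcal{U}(y,t)=\sum_{n\ge0}\mathcal{U}_n(y)\frac{t^n}{n!}$ be a power series in $t$ with coefficients depending on $y$ and $\mathcal{U}_0(y)\neq0$; the 2-variable general polynomials $T_n(x,y)$ are defined by $e^{xt}\mathcal{U}(y,t)=\sum_{n\ge0}T_n(x,y)\frac{t^n}{n!}$, with the normalization $T_0(x,y)=1$. The order $v$ is such that $\bigl(\frac{t}{\lambda e^t-1}\bigr)^v$ is a power series in $t$ ($v\in\mathbb{N}_0$ in general; $v\in\mathbb{C}$ allowed when $\lambda=1$, with the branch $1^v=1$ at $t=0$). The cosine parametric kind of generalized Apostol--Bernoulli polynomials is defined, as power series in $t$, by $$\Bigl(\frac{t}{\lambda e^t-1}\Bigr)^v e^{xt}\,\mathcal{U}(y,t)\cos(zt)=\sum_{n=0}^\infty {}_{T}B_{n}^{(c,v)}(x,y,z;\lambda)\frac{t^n}{n!}.$$ The convention $(\omega-x)^0=1$ is used. *)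

theory Defs
  imports Complex_Main "HOL-Computational_Algebra.Formal_Power_Series"
begin

text \<open>
  Generating functions are formal power series in the variable t (\<^const>\<open>fps_X\<close>), so that
  exp (x t) is \<^term>\<open>fps_exp x\<close> and cos (z t) is \<^term>\<open>fps_cos z\<close>.
  All parameters take complex values.
\<close>

definition egf :: "(nat \<Rightarrow> complex) \<Rightarrow> complex fps" where
  "egf a = Abs_fps (\<lambda>n. a n / fact n)"

definition egf_coeff :: "complex fps \<Rightarrow> nat \<Rightarrow> complex" where
  "egf_coeff F n = fact n * fps_nth F n"

lemma egf_egf_coeff [simp]: "egf (egf_coeff F) = F"
  by (simp add: egf_def egf_coeff_def fps_eq_iff)

lemma egf_coeff_egf [simp]: "egf_coeff (egf a) n = a n"
  by (simp add: egf_def egf_coeff_def)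

text \<open>
  Powers with complex exponent. For a natural number exponent this is the ordinary power. Any other
  exponent is meaningful only for series with constant coefficient 1; there it is the binomial
  series (1 + (f - 1))^v, which is the branch with 1^v = 1 at t = 0. On such series the two
  clauses agree where they overlap (\<open>fps_cpow_eq_binomial\<close>).
\<close>

definition fps_cpow :: "complex fps \<Rightarrow> complex \<Rightarrow> complex fps" where
  "fps_cpow f v =
    (if v \<in> \<nat> then f ^ (THE k. v = of_nat k) else fps_binomial v oo (f - 1))"

lemma fps_cpow_of_nat [simp]: "fps_cpow f (of_nat k) = f ^ k"
  by (simp add: fps_cpow_def)

lemma fps_cpow_eq_binomial:
  assumes "fps_nth f 0 = 1"
  shows "fps_cpow f v = fps_binomial v oo (f - 1)"
proof (cases "v \<in> \<nat>")
  case True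
  then obtain k where k: "v = of_nat k" by (auto simp: Nats_def)
  have "fps_binomial v oo (f - 1) = ((1 + fps_X) ^ k) oo (f - 1)"
    by (simp add: k fps_binomial_of_nat)
  also have "\<dots> = ((1 + fps_X) oo (f - 1)) ^ k"
    using assms by (simp add: fps_compose_power)
  also have "\<dots> = f ^ k"
    using assms by (simp add: fps_compose_add_distrib)
  finally show ?thesis by (simp add: k)
qed (simp add: fps_cpow_def)

text \<open>
  The series t / (\<lambda> exp t - 1). For \<lambda> = 1 the denominator has no constant term, but division of
  formal power series over a field cancels the common factor t.
\<close>

definition apostol_base :: "complex \<Rightarrow> complex fps" where
  "apostol_base lam = fps_X / (fps_const lam * fps_exp 1 - 1)"

lemma apostol_base_mult:
  "apostol_base lam * (fps_const lam * fps_exp 1 - 1) = fps_X"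
proof -
  let ?d = "fps_const lam * fps_exp 1 - 1 :: complex fps"
  have n0: "fps_nth ?d 0 = lam - 1" and n1: "fps_nth ?d 1 = lam"
    by simp_all
  obtain i where i: "i \<le> 1" "fps_nth ?d i \<noteq> 0"
    using n0 n1 by (metis diff_eq_eq add_0 le_refl zero_le zero_neq_one)
  then have nz: "?d \<noteq> 0"
    by (metis fps_zero_nth)
  have "subdegree ?d \<le> subdegree (fps_X :: complex fps)"
    using subdegree_leI[OF i(2)] i(1) by simp
  with nz have "?d dvd fps_X"
    by (simp add: fps_dvd_iff)
  then show ?thesis
    by (simp add: apostol_base_def)
qed

lemma apostol_base_1_nth_0: "fps_nth (apostol_base 1) 0 = 1"
  using arg_cong[OF apostol_base_mult[of 1], of "\<lambda>f. fps_nth f 1"]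
  by (simp add: fps_mult_nth)

definition gen_poly_T :: "(nat \<Rightarrow> complex \<Rightarrow> complex) \<Rightarrow> nat \<Rightarrow> complex \<Rightarrow> complex \<Rightarrow> complex" where
  "gen_poly_T U n x y = egf_coeff (fps_exp x * egf (\<lambda>k. U k y)) n"

definition apostol_bernoulli_cos ::
  "(nat \<Rightarrow> complex \<Rightarrow> complex) \<Rightarrow> complex \<Rightarrow> nat \<Rightarrow> complex \<Rightarrow> complex \<Rightarrow> complex \<Rightarrow> complex \<Rightarrow> complex"
  where
  "apostol_bernoulli_cos U v n x y z lam =
    egf_coeff (fps_cpow (apostol_base lam) v * fps_exp x * egf (\<lambda>k. U k y) * fps_cos z) n"

end

(*
  Changing x to omega multiplies the generating function by exp ((omega - x) t), so the coefficients
  of index n + r undergo a binomial transform. By Vandermonde, a binomial transform of length n + r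
  is the iteration of the transforms of lengths n and r.
*)
theory Submission
  imports Defs
begin

text \<open>Pascal's rule. With E the index shift, this is (1 + E)^(n+1) = (1 + E)^n + (1 + E)^n E
  applied to \<open>f\<close> at 0.\<close>

lemma sum_choose_Suc:
  fixes f :: "nat \<Rightarrow> 'a :: comm_semiring_1"
  shows "(\<Sum>k\<le>Suc n. of_nat (Suc n choose k) * f k) =
    (\<Sum>k\<le>n. of_nat (n choose k) * f k) + (\<Sum>k\<le>n. of_nat (n choose k) * f (Suc k))"
proof -
  \<comment> \<open>The added term vanishes as \<open>n choose Suc n\<close> is 0; the longer range
    lets \<open>f 0\<close> be split off by an index shift.\<close>
  have "(\<Sum>k\<le>Suc n. of_nat (n choose k) * f k) = (\<Sum>k\<le>n. of_nat (n choose k) * f k)"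
    by (simp add: binomial_eq_0)
  then have "(\<Sum>k\<le>n. of_nat (n choose k) * f k) = f 0 + (\<Sum>k\<le>n. of_nat (n choose Suc k) * f (Suc k))"
    by (simp only: sum.atMost_Suc_shift) simp
  moreover have "(\<Sum>k\<le>Suc n. of_nat (Suc n choose k) * f k) =
      f 0 + (\<Sum>k\<le>n. of_nat (Suc n choose Suc k) * f (Suc k))"
    by (simp only: sum.atMost_Suc_shift) simp
  ultimately show ?thesis
    by (simp add: distrib_right sum.distrib add_ac)
qed

text \<open>Summed form of Vandermonde: (1 + E)^(n+r) = (1 + E)^n (1 + E)^r. \<open>f\<close> is
  arbitrary in the induction because Pascal's rule also calls for the shifted
  \<open>f\<close>.\<close>

lemma sum_choose_add:
  fixes f :: "nat \<Rightarrow> 'a :: comm_semiring_1"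
  shows "(\<Sum>k\<le>n + r. of_nat (n + r choose k) * f k) =
    (\<Sum>l\<le>n. \<Sum>m\<le>r. of_nat (n choose l) * of_nat (r choose m) * f (l + m))"
proof (induction n arbitrary: f)
  case (Suc n)
  \<comment> \<open>With the inner sum as a function of \<open>l\<close>,
    \<open>sum_choose_Suc\<close> applies to the outer sum.\<close>
  have *: "(\<Sum>l\<le>N. \<Sum>m\<le>r. of_nat (N choose l) * of_nat (r choose m) * g (l + m)) =
      (\<Sum>l\<le>N. of_nat (N choose l) * (\<Sum>m\<le>r. of_nat (r choose m) * g (l + m)))"
    for N and g :: "nat \<Rightarrow> 'a"
    by (simp add: sum_distrib_left mult.assoc)
  show ?case
    using Suc.IH[of f] Suc.IH[of "\<lambda>k. f (Suc k)"] *[of n "\<lambda>k. f (Suc k)"]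
    unfolding * add_Suc sum_choose_Suc by simp
qed simp

text \<open>Products of exponential generating functions convolve binomially, and
  \<open>fps_exp w\<close> generates the powers of \<open>w\<close>.\<close>

lemma egf_coeff_fps_exp_mult:
  "egf_coeff (fps_exp w * F) N = (\<Sum>k\<le>N. of_nat (N choose k) * (w ^ k * egf_coeff F (N - k)))"
  unfolding egf_coeff_def fps_mult_nth sum_distrib_left atLeast0AtMost
  by (intro sum.cong refl) (simp add: binomial_fact)

theorem theorem3p5:
  fixes U :: "nat \<Rightarrow> complex \<Rightarrow> complex"
    and lam v x y z \<omega> :: complex
    and n r :: nat
  assumes "\<And>b. U 0 b \<noteq> 0"
    and "\<And>a b. gen_poly_T U 0 a b = 1"
    and "lam \<noteq> 0"
    and "v \<in> \<nat> \<or> lam = 1"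
  shows "apostol_bernoulli_cos U v (n + r) \<omega> y z lam =
    (\<Sum>l=0..n. \<Sum>m=0..r. of_nat (n choose l) * of_nat (r choose m) * (\<omega> - x) ^ (l + m) *
       apostol_bernoulli_cos U v (n + r - l - m) x y z lam)"
proof -
  define F where "F = fps_cpow (apostol_base lam) v * fps_exp x * egf (\<lambda>k. U k y) * fps_cos z"
  have "fps_exp \<omega> = fps_exp (\<omega> - x) * fps_exp x"
    by (simp flip: fps_exp_add_mult)
  then have "fps_cpow (apostol_base lam) v * fps_exp \<omega> * egf (\<lambda>k. U k y) * fps_cos z =
      fps_exp (\<omega> - x) * F"
    by (simp add: F_def mult_ac)
  then have "apostol_bernoulli_cos U v (n + r) \<omega> y z lam = egf_coeff (fps_exp (\<omega> - x) * F) (n + r)"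
    by (simp add: apostol_bernoulli_cos_def)
  then show ?thesis
    \<comment> \<open>Here \<open>f k\<close> is
      \<open>(\<omega> - x) ^ k * egf_coeff F (n + r - k)\<close>, taken at
      \<open>k = l + m\<close>.\<close>
    unfolding egf_coeff_fps_exp_mult sum_choose_add
    by (simp add: apostol_bernoulli_cos_def atLeast0AtMost F_def mult.assoc)
qed

end
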